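(* There exists a differentiable function $f:\mathbb{R}\to\mathbb{R}$ with compact support which is $1$-Lipschitz (i.e. $|f(x)-f(y)|\le |x-y|$ for all $x,y\in\mathbb{R}$) and such that the range of its Clarke subdifferential contains all closed subintervals and all singletons of $[-1,1]$; that is, for all real numbers $a,b$ with $-1\le a\le b\le 1$ there exists $x\in\mathbb{R}$ such that $\partial f(x)=[a,b]$ (where $[a,a]=\{a\}$).
   Context: For a locally Lipschitz function $f:\mathcal{U}\to\mathbb{R}$ on a nonempty open set $\mathcal{U}\subset\mathbb{R}^N$, let $\mathcal{D}_f$ be the set of points where $f$ is differentiable (of full Lebesgue measure by Rademacher's theorem). The Clarke subdifferential of $f$ at $x\in\mathcal{U}$ is $$\partial f(x)=\mathrm{conv}\Big\{\lim_{n\to\infty} Df(x_n)\,:\ x_n\to x,\ \{x_n\}\subset\mathcal{D}_f\setminus\mathcal{N},\ \text{the limit exists}\Big\},$$ where $\mathcal{N}\subset\mathcal{U}$ is any Lebesgue-null set (the definition does not depend on the choice of $\mathcal{N}$) and $\mathrm{conv}$ denotes the convex hull. Here $N=1$. "Differentiable" means differentiable at every point. *)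

theory Defs
  imports "HOL-Analysis.Analysis"
begin

(* D n is the gradient Df(X n); requiring GDERIV says in particular that f is differentiable
   at X n.  As usual, U is the open domain of f, f is locally Lipschitz on U, x is a point of U
   and N is a Lebesgue-null subset of U.  For such data the value does not depend on N, so N is
   kept as a parameter instead of being fixed. *)
definition clarke_subdifferential ::
    "'a::euclidean_space set \<Rightarrow> 'a set \<Rightarrow> ('a \<Rightarrow> real) \<Rightarrow> 'a \<Rightarrow> 'a set" where
  "clarke_subdifferential U N f x =
     convex hull {v. \<exists>X D. X \<longlonglongrightarrow> x \<and> (\<forall>n. X n \<in> U - N \<and> GDERIV f (X n) :> D n) \<and> D \<longlonglongrightarrow> v}"

end

theory Submission imports Defs begin

text \<open>
  The Clarke subdifferential of a differentiable function of one variable is the interval between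
  the lower and the upper limit of its derivative: null sets do not matter, because a derivative
  that exceeds \<open>m\<close> at a point exceeds it on a set of positive measure nearby.

  Let \<open>K\<close> be the Cantor set of the numbers with only the digits \<open>0\<close> and \<open>2\<close> in base \<open>4\<close>. In the
  manner of Schoenberg's curve there are continuous \<open>center\<close> and \<open>radius\<close> such that
  \<open>(center, radius)\<close> maps \<open>K\<close> onto the triangle \<open>\<bar>c\<bar> + r \<le> 1\<close>, \<open>0 \<le> r\<close>, whose points encode the
  intervals \<open>[c - r, c + r]\<close> in \<open>[-1, 1]\<close>. To an antiderivative of \<open>center\<close> one adds a \<open>C\<^sup>1\<close> bump
  in each interval of numbers whose first digit \<open>3\<close> occurs at a given position \<open>k\<close>. Its height is at
  most of order \<open>16\<^sup>-\<^sup>k\<close> and its distance to \<open>K\<close> at least of order \<open>4\<^sup>-\<^sup>k\<close>, so the sum of all bumps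
  has derivative zero on \<open>K\<close>; yet the slope of each bump takes plus and minus the infimum of
  \<open>radius\<close> over the surrounding cell, which is close to \<open>radius\<close> near \<open>K\<close>.
  Subtracting a reflected copy of \<open>center\<close> makes the support compact.
\<close>

section \<open>Clarke subdifferentials of differentiable functions of one variable\<close>

text \<open>Otherwise \<open>g\<close> is at most \<open>m\<close> off \<open>N\<close> near
  \<open>y\<close>. A derivative is always gauge integrable and the integral ignores
  \<open>N\<close>, so the right difference quotients at \<open>y\<close>, and with them
  \<open>g y\<close>, are at most \<open>m\<close>.\<close>

lemma deriv_exceeds_off_negligible:
  fixes f g :: "real \<Rightarrow> real"
  assumes deriv: "\<And>x. (f has_real_derivative g x) (at x)"
    and N: "negligible N" and "m < g y" and "0 < e"
  shows "\<exists>z. \<bar>z - y\<bar> < e \<and> z \<notin> N \<and> m < g z"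
proof (rule ccontr)
  assume "\<not> ?thesis"
  then have le: "g z \<le> m" if "\<bar>z - y\<bar> < e" "z \<notin> N" for z
    using that by force
  have incr: "f z - f y \<le> m * (z - y)" if z: "y < z" "z < y + e" for z
  proof -
    have "(g has_integral f z - f y) {y..z}"
      using z by (intro fundamental_theorem_of_calculus)
        (auto simp flip: has_real_derivative_iff_has_vector_derivative
           intro: has_field_derivative_at_within deriv)
    then have "((\<lambda>t. if t \<in> N then m else g t) has_integral f z - f y) {y..z}"
      by (rule has_integral_spike[OF N, rotated]) auto
    moreover have "((\<lambda>t. m) has_integral m * (z - y)) {y..z}"
      using has_integral_const_real[of m y z] z by (simp add: mult.commute)
    ultimately show ?thesis
      by (rule has_integral_le) (use le z in auto)
  qed
  have "((\<lambda>z. (f z - f y) / (z - y)) \<longlongrightarrow> g y) (at_right y)"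
    using deriv[of y] by (auto simp: has_field_derivative_iff intro: tendsto_within_subset)
  moreover have "\<forall>\<^sub>F z in at_right y. (f z - f y) / (z - y) \<le> m"
    unfolding eventually_at_right_field
    using \<open>0 < e\<close> incr by (intro exI[of _ "y + e"]) (auto simp: divide_le_eq)
  ultimately have "g y \<le> m"
    by (rule tendsto_upperbound) simp
  then show False
    using \<open>m < g y\<close> by simp
qed

text \<open>The points in \<open>attained\<close> may lie in \<open>N\<close>; the previous lemma
  trades them for nearby points off \<open>N\<close> with the same lower bound on
  \<open>g\<close>.\<close>

lemma limiting_derivative_off_negligible:
  fixes f g :: "real \<Rightarrow> real"
  assumes deriv: "\<And>x. (f has_real_derivative g x) (at x)"
    and N: "negligible N"
    and upper: "\<And>e. 0 < e \<Longrightarrow> \<forall>\<^sub>F y in nhds x. g y < b + e"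
    and attained: "\<And>e. 0 < e \<Longrightarrow> \<exists>y. \<bar>y - x\<bar> < e \<and> b - e < g y"
  shows "\<exists>X. X \<longlonglongrightarrow> x \<and> (\<forall>n. X n \<notin> N) \<and> (\<lambda>n. g (X n)) \<longlonglongrightarrow> b"
proof -
  define r where "r n = inverse (real (Suc n))" for n
  have r: "0 < r n" "r \<longlonglongrightarrow> 0" for n
    unfolding r_def by (simp, rule LIMSEQ_inverse_real_of_nat)
  have "\<exists>z. \<bar>z - x\<bar> < r n \<and> z \<notin> N \<and> b - r n < g z" for n
  proof -
    obtain y where y: "\<bar>y - x\<bar> < r n" "b - r n < g y"
      using attained[of "r n"] r by auto
    obtain z where "\<bar>z - y\<bar> < r n - \<bar>y - x\<bar>" "z \<notin> N" "b - r n < g z"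
      using deriv_exceeds_off_negligible[OF deriv N y(2), of "r n - \<bar>y - x\<bar>"] y(1) by auto
    then show ?thesis
      by (intro exI[of _ z]) linarith
  qed
  then obtain X where X: "\<And>n. \<bar>X n - x\<bar> < r n" "\<And>n. X n \<notin> N" "\<And>n. b - r n < g (X n)"
    by metis
  have lim: "X \<longlonglongrightarrow> x"
    by (rule LIMSEQ_I)
      (use X(1) r(2) in \<open>force simp: LIMSEQ_iff intro: less_trans\<close>)
  have "(\<lambda>n. g (X n)) \<longlonglongrightarrow> b"
  proof (rule order_tendstoI)
    fix a assume "a < b"
    have "(\<lambda>n. b - r n) \<longlonglongrightarrow> b - 0"
      by (intro tendsto_intros r)
    then have "\<forall>\<^sub>F n in sequentially. a < b - r n"
      using \<open>a < b\<close> by (auto intro: order_tendstoD)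
    then show "\<forall>\<^sub>F n in sequentially. a < g (X n)"
      by eventually_elim (use X(3) in \<open>meson less_trans\<close>)
  next
    fix a assume "b < a"
    then show "\<forall>\<^sub>F n in sequentially. g (X n) < a"
      using eventually_compose_filterlim[OF upper[of "a - b"] lim] by simp
  qed
  then show ?thesis
    using lim X(2) by blast
qed

text \<open>The bounds near \<open>x\<close> confine all limits to \<open>{a..b}\<close>. Both end
  points are limits, and the convex hull fills in the rest.\<close>

lemma clarke_subdifferential_eqI:
  fixes f g :: "real \<Rightarrow> real"
  assumes deriv: "\<And>x. (f has_real_derivative g x) (at x)"
    and N: "N \<in> null_sets lebesgue"
    and upper: "\<And>e. 0 < e \<Longrightarrow> \<forall>\<^sub>F y in nhds x. g y < b + e"
    and lower: "\<And>e. 0 < e \<Longrightarrow> \<forall>\<^sub>F y in nhds x. a - e < g y"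
    and sup: "\<And>e. 0 < e \<Longrightarrow> \<exists>y. \<bar>y - x\<bar> < e \<and> b - e < g y"
    and inf: "\<And>e. 0 < e \<Longrightarrow> \<exists>y. \<bar>y - x\<bar> < e \<and> g y < a + e"
    and "a \<le> b"
  shows "clarke_subdifferential UNIV N f x = {a..b}"
proof -
  have gderiv: "GDERIV f t :> D \<longleftrightarrow> D = g t" for t D
  proof -
    have "GDERIV f t :> D \<longleftrightarrow> (f has_real_derivative D) (at t)"
      by (simp add: gderiv_def has_field_derivative_def mult_commute_abs)
    then show ?thesis
      using deriv[of t] DERIV_unique by blast
  qed
  let ?L = "{v. \<exists>X D. X \<longlonglongrightarrow> x \<and> (\<forall>n. X n \<in> UNIV - N \<and> GDERIV f (X n) :> D n) \<and> D \<longlonglongrightarrow> v}"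
  have N': "negligible N"
    using N by (simp add: negligible_iff_null_sets)
  have memL: "v \<in> ?L" if ex: "\<exists>X. X \<longlonglongrightarrow> x \<and> (\<forall>n. X n \<notin> N) \<and> (\<lambda>n. g (X n)) \<longlonglongrightarrow> v" for v
  proof -
    obtain X where "X \<longlonglongrightarrow> x" "\<forall>n. X n \<notin> N" "(\<lambda>n. g (X n)) \<longlonglongrightarrow> v"
      using ex by blast
    then show ?thesis
      unfolding gderiv by (intro CollectI exI[of _ X] exI[of _ "\<lambda>n. g (X n)"]) simp
  qed
  have "b \<in> ?L"
    by (intro memL limiting_derivative_off_negligible[OF deriv N' upper sup])
  \<comment> \<open>The lower end for \<open>f\<close> is the upper end for its negative.\<close>
  moreover have "a \<in> ?L"
  proof -
    have "((\<lambda>t. - f t) has_real_derivative - g t) (at t)" for t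
      by (intro derivative_intros deriv)
    moreover have "\<forall>\<^sub>F y in nhds x. - g y < - a + e" if "0 < e" for e
      using lower[OF that] by eventually_elim linarith
    moreover have "\<exists>y. \<bar>y - x\<bar> < e \<and> - a - e < - g y" if "0 < e" for e
      using inf[OF that] by (auto simp: algebra_simps)
    ultimately have "\<exists>X. X \<longlonglongrightarrow> x \<and> (\<forall>n. X n \<notin> N) \<and> (\<lambda>n. - g (X n)) \<longlonglongrightarrow> - a"
      using limiting_derivative_off_negligible[OF _ N', of "\<lambda>t. - f t" "\<lambda>t. - g t" "- a" x] by blast
    then show ?thesis
      by (intro memL) (simp add: tendsto_minus_cancel_left)
  qed
  ultimately have "{a..b} \<subseteq> convex hull ?L"
    using \<open>a \<le> b\<close> closed_segment_subset_convex_hull[of a ?L b]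
    by (simp add: hull_inc closed_segment_eq_real_ivl del: mem_Collect_eq)
  moreover have "?L \<subseteq> {a..b}"
  proof
    fix v assume "v \<in> ?L"
    then obtain X D where X: "X \<longlonglongrightarrow> x" and "\<forall>n. GDERIV f (X n) :> D n" and "D \<longlonglongrightarrow> v"
      by blast
    moreover from this have "D = (\<lambda>n. g (X n))"
      unfolding gderiv by blast
    ultimately have v: "(\<lambda>n. g (X n)) \<longlonglongrightarrow> v"
      by simp
    have "v \<le> b + e" if "0 < e" for e
      using eventually_compose_filterlim[OF upper[OF that] X]
      by (intro tendsto_upperbound[OF v]) (auto elim: eventually_mono)
    moreover have "a \<le> v + e" if "0 < e" for e
    proof -
      have "a - e \<le> v"
        using eventually_compose_filterlim[OF lower[OF that] X]
        by (intro tendsto_lowerbound[OF v]) (auto elim: eventually_mono)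
      then show ?thesis by simp
    qed
    ultimately show "v \<in> {a..b}"
      by (auto intro: field_le_epsilon)
  qed
  then have "convex hull ?L \<subseteq> {a..b}"
    by (intro hull_minimal) auto
  ultimately show ?thesis
    unfolding clarke_subdifferential_def by blast
qed

section \<open>A continuously differentiable bump\<close>

definition wave :: "real \<Rightarrow> real" where
  "wave t = (if \<bar>t\<bar> \<le> pi then 1 + cos t else 0)"

definition wave' :: "real \<Rightarrow> real" where
  "wave' t = (if \<bar>t\<bar> \<le> pi then - sin t else 0)"

text \<open>The two pieces can be glued because \<open>1 + cos t\<close> and its derivative both
  vanish at \<open>-pi\<close> and \<open>pi\<close>.\<close>

lemma wave_deriv: "(wave has_real_derivative wave' t) (at t)"
proof -
  have UNIV: "UNIV = {-pi..pi} \<union> ({..<-pi} \<union> {pi<..})"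
    by auto
  have "((\<lambda>t. if t \<in> {-pi..pi} then 1 + cos t else 0) has_derivative
      (if t \<in> {-pi..pi} then (\<lambda>h. - sin t * h) else (\<lambda>h. 0))) (at t within UNIV)"
    unfolding UNIV
    by (rule has_derivative_If_within_closures[where T = "{..<-pi} \<union> {pi<..}"])
      (auto intro!: derivative_eq_intros)
  moreover have "(\<lambda>t. if t \<in> {-pi..pi} then 1 + cos t else 0) = wave"
    by (auto simp: wave_def fun_eq_iff)
  ultimately show ?thesis
    by (auto simp: has_field_derivative_def wave'_def fun_eq_iff elim!: has_derivative_eq_rhs)
qed

lemma wave_bounds: "0 \<le> wave t" "wave t \<le> 2" "\<bar>wave' t\<bar> \<le> 1"
  unfolding wave_def wave'_def
  using cos_le_one[of t] cos_ge_minus_one[of t] abs_sin_le_one[of t] by (simp_all, linarith)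

section \<open>Base 4 cells and the gaps of the Cantor set\<close>

text \<open>Cells are nested: the coarser floor is the integer quotient of the finer one by
  \<open>4 ^ (k - i)\<close>.\<close>

lemma floor_coarsen:
  fixes x y :: real
  assumes "\<lfloor>4 ^ k * x\<rfloor> = \<lfloor>4 ^ k * y\<rfloor>" "i \<le> k"
  shows "\<lfloor>4 ^ i * x\<rfloor> = \<lfloor>4 ^ i * y\<rfloor>"
proof -
  have "\<lfloor>4 ^ i * t\<rfloor> = \<lfloor>4 ^ k * t\<rfloor> div 4 ^ (k - i)" for t :: real
  proof -
    have "(4::real) ^ k = 4 ^ i * 4 ^ (k - i)"
      using \<open>i \<le> k\<close> by (simp flip: power_add)
    then have "4 ^ i * t = (4 ^ k * t) / real_of_int (4 ^ (k - i))"
      by simp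
    then show ?thesis
      using floor_divide_real_eq_div[of "4 ^ (k - i)" "4 ^ k * t"] by simp
  qed
  then show ?thesis
    using assms by simp
qed

text \<open>Two consecutive floors tell whether the digit at position \<open>i\<close> is 3, and the
  cell at level \<open>k\<close> fixes both. The conclusion is weak because \<open>x\<close> may be
  a left end point, with fractional part exactly 3/4.\<close>

lemma frac_coarsen:
  fixes x y :: real
  assumes eq: "\<lfloor>4 ^ k * x\<rfloor> = \<lfloor>4 ^ k * y\<rfloor>" and "i < k" and y: "3/4 < frac (4 ^ i * y)"
  shows "3/4 \<le> frac (4 ^ i * x)"
proof -
  have "\<lfloor>4 ^ i * x\<rfloor> = \<lfloor>4 ^ i * y\<rfloor>" "\<lfloor>4 ^ Suc i * x\<rfloor> = \<lfloor>4 ^ Suc i * y\<rfloor>"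
    using \<open>i < k\<close> by (auto intro!: floor_coarsen[OF eq] simp del: power_Suc)
  moreover have "4 * \<lfloor>4 ^ i * y\<rfloor> + 3 \<le> \<lfloor>4 ^ Suc i * y\<rfloor>"
    using y by (simp add: le_floor_iff frac_def)
  ultimately have "4 * \<lfloor>4 ^ i * x\<rfloor> + 3 \<le> \<lfloor>4 ^ Suc i * x\<rfloor>"
    by simp
  then show ?thesis
    by (simp add: le_floor_iff frac_def)
qed

text \<open>Positions are counted from 0. The strict inequality drops left end points, which makes
  the gaps open.\<close>

definition gap :: "nat \<Rightarrow> real \<Rightarrow> bool" where
  "gap k x \<longleftrightarrow> 3/4 < frac (4 ^ k * x) \<and> (\<forall>i<k. frac (4 ^ i * x) \<le> 3/4)"

lemma gap_unique: "gap k x \<Longrightarrow> gap l x \<Longrightarrow> k = l"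
  unfolding gap_def by (metis linorder_neqE_nat not_less)

lemma gap_exists: "3/4 < frac (4 ^ k * x) \<Longrightarrow> \<exists>l. gap l x"
  unfolding gap_def
  using exists_least_iff[of "\<lambda>k. 3/4 < frac (4 ^ k * x)"] by (meson not_less)

lemma gap_neighborhood:
  assumes "gap k x"
  shows "\<forall>\<^sub>F y in nhds x. gap k y \<and> \<lfloor>4 ^ k * y\<rfloor> = \<lfloor>4 ^ k * x\<rfloor>"
proof -
  define n where "n = \<lfloor>4 ^ k * x\<rfloor>"
  have x: "3/4 < frac (4 ^ k * x)" "\<And>i. i < k \<Longrightarrow> frac (4 ^ i * x) \<le> 3/4"
    using assms by (auto simp: gap_def)
  \<comment> \<open>The closed conditions on earlier digits are in fact strict at \<open>x\<close>:
    equality would make \<open>4 ^ k * x\<close> an integer. Hence they persist nearby.\<close>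
  have ne: "frac (4 ^ i * x) \<noteq> 3/4" if "i < k" for i
  proof
    assume "frac (4 ^ i * x) = 3/4"
    then have "4 ^ Suc i * x = of_int (4 * \<lfloor>4 ^ i * x\<rfloor> + 3)"
      by (simp add: frac_def)
    moreover have "4 ^ k * x = 4 ^ (k - Suc i) * (4 ^ Suc i * x)"
      using \<open>i < k\<close> by (simp flip: power_add mult.assoc del: power_Suc)
    ultimately have "4 ^ k * x \<in> \<int>"
      by simp
    then show False
      using x(1) by (simp add: frac_eq_0_iff[THEN iffD2])
  qed
  have "open {real_of_int n + 3/4 <..< n + 1}" "4 ^ k * x \<in> {real_of_int n + 3/4 <..< n + 1}"
    using x(1) by (auto simp: n_def frac_def)
  then have "\<forall>\<^sub>F y in nhds x. 4 ^ k * y \<in> {real_of_int n + 3/4 <..< n + 1}"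
    by (intro eventually_compose_filterlim[OF eventually_nhds_in_open])
      (auto intro!: tendsto_eq_intros filterlim_ident)
  then show ?thesis
  proof eventually_elim
    case (elim y)
    then have n: "\<lfloor>4 ^ k * y\<rfloor> = n"
      by (auto simp: floor_eq_iff)
    have "frac (4 ^ i * y) \<le> 3/4" if "i < k" for i
      using frac_coarsen[of k x y i] n n_def x(2)[of i] ne[of i] that by force
    then show ?case
      using elim n by (auto simp: gap_def n_def frac_def)
  qed
qed

text \<open>The infimum over the cell makes the amplitude locally constant, hence harmless when
  differentiating, while keeping it at most \<open>d\<close> pointwise.\<close>

definition cell_amp :: "(real \<Rightarrow> real) \<Rightarrow> nat \<Rightarrow> real \<Rightarrow> real" where
  "cell_amp d k x = Inf (d ` {y. \<lfloor>4 ^ k * y\<rfloor> = \<lfloor>4 ^ k * x\<rfloor>})"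

lemma cell_amp_bounds:
  assumes "\<And>y. 0 \<le> d y"
  shows "0 \<le> cell_amp d k x" "cell_amp d k x \<le> d x"
  unfolding cell_amp_def
  by (rule cINF_greatest, use assms in auto, rule cINF_lower)
    (use assms in \<open>auto intro!: bdd_belowI2\<close>)

section \<open>The sum of the bumps and its derivative\<close>

text \<open>Centred at 7/8, the middle of the last quarter of a cell. Values in
  \<open>[-pi, pi]\<close> force a fractional part within 1/16 of 7/8, well inside the gap.\<close>

definition ripple_arg :: "nat \<Rightarrow> real \<Rightarrow> real" where
  "ripple_arg k x = 16 * pi * (4 ^ k * (frac (4 ^ k * x) - 7/8))"

text \<open>The divisor \<open>16 * pi * 16 ^ k\<close> is the slope of \<open>ripple_arg k\<close>
  inside a cell, so it cancels in the chain rule.\<close>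

definition ripple :: "(real \<Rightarrow> real) \<Rightarrow> real \<Rightarrow> real" where
  "ripple d x = (if \<exists>k. gap k x
     then let k = THE k. gap k x in cell_amp d k x * wave (ripple_arg k x) / (16 * pi * 16 ^ k)
     else 0)"

definition ripple' :: "(real \<Rightarrow> real) \<Rightarrow> real \<Rightarrow> real" where
  "ripple' d x = (if \<exists>k. gap k x
     then let k = THE k. gap k x in cell_amp d k x * wave' (ripple_arg k x)
     else 0)"

lemma ripple_gap:
  assumes "gap k x"
  shows "ripple d x = cell_amp d k x * wave (ripple_arg k x) / (16 * pi * 16 ^ k)"
    "ripple' d x = cell_amp d k x * wave' (ripple_arg k x)"
proof -
  have "(THE k. gap k x) = k"
    using assms gap_unique by blast
  then show "ripple d x = cell_amp d k x * wave (ripple_arg k x) / (16 * pi * 16 ^ k)"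
    "ripple' d x = cell_amp d k x * wave' (ripple_arg k x)"
    using assms by (auto simp: ripple_def ripple'_def Let_def)
qed

lemma ripple'_le:
  assumes "\<And>y. 0 \<le> d y"
  shows "\<bar>ripple' d x\<bar> \<le> d x"
proof (cases "\<exists>k. gap k x")
  case True
  then obtain k where "gap k x" by blast
  have "\<bar>cell_amp d k x * wave' (ripple_arg k x)\<bar> \<le> cell_amp d k x * 1"
    unfolding abs_mult using cell_amp_bounds[of d, OF assms]
    by (intro mult_mono wave_bounds) auto
  then show ?thesis
    using ripple_gap(2)[OF \<open>gap k x\<close>] cell_amp_bounds(2)[of d, OF assms] by (metis mult.right_neutral order_trans)
qed (use assms in \<open>simp add: ripple'_def\<close>)

lemma ripple_eq_0:
  assumes "\<And>y. 0 \<le> d y" "d x = 0"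
  shows "ripple d x = 0"
  using cell_amp_bounds[of d _ x] assms by (auto simp: ripple_def Let_def order_antisym)

text \<open>In a gap, \<open>ripple d\<close> is locally a single bump. Off the gaps it vanishes to
  second order: a bump of level \<open>k\<close> has height at most \<open>16 ^ -k\<close> and lies
  at distance at least \<open>4 ^ -k / 16\<close>.\<close>

lemma ripple_deriv:
  assumes d: "\<And>y. 0 \<le> d y" "\<And>y. d y \<le> 1"
  shows "(ripple d has_real_derivative ripple' d x) (at x)"
proof (cases "\<exists>k. gap k x")
  case True
  then obtain k where k: "gap k x" by blast
  define n where "n = \<lfloor>4 ^ k * x\<rfloor>"
  define h where "h y = cell_amp d k x * wave (16 * pi * (4 ^ k * (4 ^ k * y - n - 7/8))) / (16 * pi * 16 ^ k)" for y :: real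
  have "16 ^ k = (4 ^ k * 4 ^ k :: real)"
    by (simp flip: power_mult_distrib)
  then have "(h has_real_derivative
      cell_amp d k x * wave' (16 * pi * (4 ^ k * (4 ^ k * x - n - 7/8)))) (at x)"
    unfolding h_def by (auto intro!: derivative_eq_intros DERIV_chain2[OF wave_deriv])
  moreover have "cell_amp d k x * wave' (16 * pi * (4 ^ k * (4 ^ k * x - n - 7/8))) = ripple' d x"
    using ripple_gap(2)[OF k] by (simp add: ripple_arg_def n_def frac_def)
  moreover have "\<forall>\<^sub>F y in nhds x. h y = ripple d y"
    using gap_neighborhood[OF k]
    by eventually_elim (auto simp: ripple_gap(1) h_def cell_amp_def ripple_arg_def n_def frac_def)
  ultimately show ?thesis
    using DERIV_cong_ev[of x x h "ripple d"] by simp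
next
  case False
  then have x: "frac (4 ^ k * x) \<le> 3/4" for k
    using gap_exists not_less by blast
  have bound: "\<bar>ripple d y\<bar> \<le> 256 * \<bar>y - x\<bar> * \<bar>y - x\<bar>" for y
  proof (cases "ripple d y = 0")
    case nz: False
    then obtain k where k: "gap k y"
      by (auto simp: ripple_def split: if_splits)
    have y: "13/16 \<le> frac (4 ^ k * y) \<and> frac (4 ^ k * y) \<le> 15/16"
    proof -
      define w where "w = frac (4 ^ k * y) - 7/8"
      have "\<bar>ripple_arg k y\<bar> \<le> pi"
        using nz ripple_gap(1)[OF k, of d] by (auto simp: wave_def split: if_splits)
      then have "pi * (16 * 4 ^ k * \<bar>w\<bar>) \<le> pi * 1"
        unfolding ripple_arg_def w_def[symmetric] by (simp add: abs_mult mult_ac)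
      then have "16 * 4 ^ k * \<bar>w\<bar> \<le> 1"
        by (simp only: mult_le_cancel_left_pos[OF pi_gt_zero])
      moreover have "16 * 1 * \<bar>w\<bar> \<le> 16 * 4 ^ k * \<bar>w\<bar>"
        by (intro mult_right_mono mult_left_mono) auto
      ultimately have "16 * \<bar>w\<bar> \<le> 1"
        by simp
      then show ?thesis
        by (simp add: w_def abs_if split: if_splits)
    qed
    \<comment> \<open>In the same cell, \<open>x\<close> lies at or below the mark 3/4 and
      \<open>y\<close> at or above 13/16; otherwise \<open>y\<close> keeps 1/16 from the ends of its
      cell. Squaring gives the constant 256.\<close>
    have "1/16 \<le> \<bar>4 ^ k * y - 4 ^ k * x\<bar>"
    proof (cases "\<lfloor>4 ^ k * x\<rfloor> = \<lfloor>4 ^ k * y\<rfloor>")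
      case True
      then show ?thesis using x[of k] y unfolding frac_def by linarith
    next
      case False
      then have "\<lfloor>4 ^ k * x\<rfloor> + 1 \<le> \<lfloor>4 ^ k * y\<rfloor> \<or> \<lfloor>4 ^ k * y\<rfloor> + 1 \<le> \<lfloor>4 ^ k * x\<rfloor>"
        by linarith
      then have "real_of_int \<lfloor>4 ^ k * x\<rfloor> + 1 \<le> \<lfloor>4 ^ k * y\<rfloor> \<or> real_of_int \<lfloor>4 ^ k * y\<rfloor> + 1 \<le> \<lfloor>4 ^ k * x\<rfloor>"
        by linarith
      then show ?thesis
        using x[of k] y frac_ge_0[of "4 ^ k * x"] unfolding frac_def by linarith
    qed
    then have "1 \<le> 4 ^ k * (16 * \<bar>y - x\<bar>)"
      by (simp flip: right_diff_distrib add: abs_mult)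
    then have "1 * 1 \<le> (4 ^ k * (16 * \<bar>y - x\<bar>)) * (4 ^ k * (16 * \<bar>y - x\<bar>))"
      by (intro mult_mono) auto
    also have "\<dots> = (4 * 4) ^ k * (256 * \<bar>y - x\<bar> * \<bar>y - x\<bar>)"
      unfolding power_mult_distrib by (simp only: mult_ac)
    finally have inv: "1 / 16 ^ k \<le> 256 * \<bar>y - x\<bar> * \<bar>y - x\<bar>"
      by (simp add: divide_le_eq mult_ac)
    have "\<bar>cell_amp d k y * wave (ripple_arg k y)\<bar> \<le> 1 * 2"
      unfolding abs_mult
      using cell_amp_bounds[of d k y, OF d(1)] d(2)[of y] wave_bounds(1,2)[of "ripple_arg k y"]
      by (intro mult_mono) auto
    also have "1 * 2 \<le> 16 * pi"
      using pi_gt3 by simp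
    finally have "\<bar>ripple d y\<bar> \<le> (16 * pi) / (16 * pi * 16 ^ k)"
      using divide_right_mono[of "\<bar>cell_amp d k y * wave (ripple_arg k y)\<bar>" "16 * pi" "16 * pi * 16 ^ k"]
      by (simp only: ripple_gap(1)[OF k] abs_divide) (simp add: abs_mult)
    also have "\<dots> = 1 / 16 ^ k"
      by simp
    finally show ?thesis
      using inv by linarith
  qed auto
  have "ripple d x = 0" "ripple' d x = 0"
    using False by (auto simp: ripple_def ripple'_def)
  moreover have "(\<lambda>y. ripple d y / (y - x)) \<midarrow>x\<rightarrow> 0"
  proof (rule Lim_null_comparison)
    show "\<forall>\<^sub>F y in at x. norm (ripple d y / (y - x)) \<le> 256 * \<bar>y - x\<bar>"
      using bound by (auto simp: eventually_at_filter divide_le_eq abs_divide)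
    show "(\<lambda>y. 256 * \<bar>y - x\<bar>) \<midarrow>x\<rightarrow> 0"
      by (auto intro!: tendsto_eq_intros)
  qed
  ultimately show ?thesis
    by (simp add: has_field_derivative_iff)
qed

text \<open>Each cell around \<open>x\<close> ends in a gap of its own level, since the earlier
  digits are those of \<open>x\<close>. The bump there has slopes plus and minus the amplitude,
  which tends to \<open>d x\<close> by continuity as the cells shrink.\<close>

lemma ripple'_oscillation:
  assumes cont: "isCont d x" and d: "\<And>y. 0 \<le> d y"
    and x: "\<And>k. frac (4 ^ k * x) < 3/4" and "0 < e" and \<sigma>: "\<bar>\<sigma>\<bar> = 1"
  shows "\<exists>y. \<bar>y - x\<bar> < e \<and> \<bar>ripple' d y - \<sigma> * d x\<bar> < e"
proof -
  obtain \<delta> where \<delta>: "0 < \<delta>" "\<And>y. \<bar>y - x\<bar> < \<delta> \<Longrightarrow> \<bar>d y - d x\<bar> < e/2"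
    using cont \<open>0 < e\<close> unfolding continuous_at_eps_delta by (metis dist_real_def half_gt_zero)
  obtain k where k: "inverse (4 ^ k) < min e \<delta>"
    using real_arch_pow_inv[of "min e \<delta>" "1/4"] \<open>0 < e\<close> \<open>0 < \<delta>\<close> by (auto simp: power_divide inverse_eq_divide)
  define n where "n = \<lfloor>4 ^ k * x\<rfloor>"
  \<comment> \<open>The point of the cell with
    \<open>ripple_arg k y = - \<sigma> * (pi / 2)\<close>, where \<open>wave'\<close> takes the
    value \<open>\<sigma>\<close>.\<close>
  define y where "y = (n + 7/8 - \<sigma> / (32 * 4 ^ k)) / 4 ^ k"
  have near: "\<bar>z - x\<bar> < min e \<delta>" if "\<lfloor>4 ^ k * z\<rfloor> = n" for z :: real
  proof -
    have "\<bar>4 ^ k * z - 4 ^ k * x\<bar> < 1"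
      using that unfolding n_def by linarith
    then have "4 ^ k * \<bar>z - x\<bar> < 1"
      by (simp flip: right_diff_distrib add: abs_mult)
    then have "\<bar>z - x\<bar> < inverse (4 ^ k)"
      by (simp add: field_simps)
    then show ?thesis using k by linarith
  qed
  define w where "w = \<sigma> / (32 * 4 ^ k)"
  have w: "\<bar>w\<bar> \<le> 1/32"
    using \<sigma> by (simp add: w_def abs_divide divide_le_eq)
  have y: "4 ^ k * y = n + 7/8 - w"
    by (simp add: y_def w_def)
  have yn: "\<lfloor>4 ^ k * y\<rfloor> = n"
    unfolding y floor_eq_iff using w by linarith
  then have fy: "frac (4 ^ k * y) = 7/8 - \<sigma> / (32 * 4 ^ k)"
    using y by (simp add: frac_def w_def)
  then have "3/4 < frac (4 ^ k * y)"
    using w unfolding w_def by linarith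
  then have gap: "gap k y"
    unfolding gap_def using frac_coarsen[of k x y] yn x by (auto simp: n_def not_le[symmetric] simp del: not_le)
  have "ripple_arg k y = - \<sigma> * (pi / 2)"
    unfolding ripple_arg_def fy by simp
  moreover have "\<sigma> = 1 \<or> \<sigma> = -1"
    using \<sigma> by linarith
  ultimately have "wave' (ripple_arg k y) = \<sigma>"
    by (auto simp: wave'_def)
  then have "ripple' d y = \<sigma> * cell_amp d k x"
    using ripple_gap(2)[OF gap] yn by (simp add: cell_amp_def n_def)
  moreover have "d x - e/2 \<le> cell_amp d k x"
    unfolding cell_amp_def
  proof (rule cINF_greatest)
    fix z :: real assume "z \<in> {y. \<lfloor>4 ^ k * y\<rfloor> = \<lfloor>4 ^ k * x\<rfloor>}"
    then have "\<bar>z - x\<bar> < \<delta>"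
      using near[of z] by (simp add: n_def)
    then show "d x - e/2 \<le> d z"
      using \<delta>(2)[of z] by linarith
  qed auto
  moreover have "cell_amp d k x \<le> d x"
    by (rule cell_amp_bounds) (rule d)
  ultimately have "\<bar>ripple' d y - \<sigma> * d x\<bar> < e"
    using \<sigma> \<open>0 < e\<close> by (simp flip: right_diff_distrib add: abs_mult)
  then show ?thesis
    using near[OF yn] by auto
qed

section \<open>Schoenberg's curve on the Cantor set\<close>

text \<open>A continuous function of period 1 that is 0 on \<open>[0, 1/6]\<close> and 1 on
  \<open>[1/2, 2/3]\<close>. These intervals hold the points of the Cantor set with first digit 0
  and 2, respectively.\<close>

definition digit_detector :: "real \<Rightarrow> real" where
  "digit_detector t = max 0 (min 1 (1/2 - cos (2 * pi * t)))"

definition schoenberg :: "nat \<Rightarrow> real \<Rightarrow> real" where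
  "schoenberg m x = (\<Sum>k. digit_detector (4 ^ (2 * k + m) * x) / 2 ^ Suc k)"

lemma sums_half_powers: "(\<lambda>k. 1 / 2 ^ Suc k :: real) sums 1"
  using power_half_series by (simp add: power_divide)

lemma digit_detector_bounds: "0 \<le> digit_detector t" "digit_detector t \<le> 1"
  by (auto simp: digit_detector_def)

lemma digit_detector_int: "t \<in> \<int> \<Longrightarrow> digit_detector t = 0"
  by (elim Ints_cases) (simp add: digit_detector_def cos_int_2pin)

lemma continuous_schoenberg: "continuous_on UNIV (schoenberg m)"
proof -
  have cont: "continuous_on UNIV (\<lambda>x. digit_detector (4 ^ (2 * k + m) * x) / 2 ^ Suc k)" for k
    unfolding digit_detector_def by (intro continuous_intros) simp
  have "norm (digit_detector (4 ^ (2 * k + m) * x) / 2 ^ Suc k) \<le> 1 / 2 ^ Suc k" for k x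
    using digit_detector_bounds[of "4 ^ (2 * k + m) * x"] by (simp add: divide_right_mono)
  then have "uniform_limit UNIV (\<lambda>n x. \<Sum>k<n. digit_detector (4 ^ (2 * k + m) * x) / 2 ^ Suc k)
      (schoenberg m) sequentially"
    unfolding schoenberg_def
    by (rule Weierstrass_m_test) (rule sums_summable[OF sums_half_powers])
  then show ?thesis
    by (rule uniform_limit_theorem[rotated])
      (simp_all only: eventually_True cont continuous_on_sum trivial_limit_sequentially not_False_eq_True)
qed

lemma schoenberg_bounds: "0 \<le> schoenberg m x" "schoenberg m x \<le> 1"
proof -
  have le: "digit_detector (4 ^ (2 * k + m) * x) / 2 ^ Suc k \<le> 1 / 2 ^ Suc k" for k
    by (intro divide_right_mono digit_detector_bounds) auto
  have nonneg: "0 \<le> digit_detector (4 ^ (2 * k + m) * x) / 2 ^ Suc k" for k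
    using digit_detector_bounds by simp
  have sm: "summable (\<lambda>k. digit_detector (4 ^ (2 * k + m) * x) / 2 ^ Suc k)"
    by (rule summable_comparison_test'[OF sums_summable[OF sums_half_powers], of 0])
      (simp only: real_norm_def abs_of_nonneg[OF nonneg] le)
  show "0 \<le> schoenberg m x"
    unfolding schoenberg_def by (intro suminf_nonneg sm nonneg)
  show "schoenberg m x \<le> 1"
    using suminf_le[OF le sm sums_summable[OF sums_half_powers]]
    unfolding schoenberg_def sums_unique[OF sums_half_powers, symmetric] .
qed

lemma schoenberg_int: "x \<in> \<int> \<Longrightarrow> schoenberg m x = 0"
  by (simp add: schoenberg_def digit_detector_int)

lemma binary_expansion:
  fixes u :: real
  assumes "0 \<le> u" "u \<le> 1"
  shows "\<exists>\<epsilon>. (\<forall>k. \<epsilon> k \<in> {0, 1}) \<and> (\<lambda>k. \<epsilon> k / 2 ^ Suc k) sums u"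
proof -
  \<comment> \<open>The rescaled remainder of the greedy expansion. It may stay equal to 1, which
    covers \<open>u = 1\<close> with all digits 1.\<close>
  define r where "r = rec_nat u (\<lambda>_ r. if 1/2 \<le> r then 2 * r - 1 else 2 * r)"
  define \<epsilon> where "\<epsilon> k = (if 1/2 \<le> r k then 1 else 0 :: real)" for k
  have r0: "r 0 = u" and rS: "r (Suc k) = 2 * r k - \<epsilon> k" for k
    by (auto simp: r_def \<epsilon>_def)
  have r: "0 \<le> r k \<and> r k \<le> 1" for k
    by (induction k) (use assms in \<open>auto simp: r0 rS \<epsilon>_def\<close>)
  have sum: "(\<Sum>k<n. \<epsilon> k / 2 ^ Suc k) = u - r n / 2 ^ n" for n
    by (induction n) (auto simp: r0 rS field_simps)
  have "(\<lambda>n. r n / 2 ^ n) \<longlonglongrightarrow> 0"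
  proof (rule Lim_null_comparison)
    show "\<forall>\<^sub>F n in sequentially. norm (r n / 2 ^ n) \<le> (1/2) ^ n"
      using r by (simp add: power_divide divide_right_mono)
    show "(\<lambda>n. (1/2) ^ n :: real) \<longlonglongrightarrow> 0"
      by (rule LIMSEQ_power_zero) simp
  qed
  then have "(\<lambda>n. u - r n / 2 ^ n) \<longlonglongrightarrow> u - 0"
    by (intro tendsto_intros)
  then have "(\<lambda>k. \<epsilon> k / 2 ^ Suc k) sums u"
    by (simp add: sums_def sum del: power_Suc)
  then show ?thesis
    by (intro exI[of _ \<epsilon>]) (auto simp: \<epsilon>_def)
qed

text \<open>The witness has base 4 digits \<open>2 * \<epsilon> k\<close>. All its tails are at most
  2/3, hence below 3/4.\<close>

lemma point_with_digits:
  fixes \<epsilon> :: "nat \<Rightarrow> real"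
  assumes \<epsilon>: "\<And>k. \<epsilon> k \<in> {0, 1}"
  shows "\<exists>x. 0 \<le> x \<and> x < 1 \<and> (\<forall>k. frac (4 ^ k * x) < 3/4 \<and> digit_detector (4 ^ k * x) = \<epsilon> k)"
proof -
  have \<epsilon>01: "0 \<le> \<epsilon> k" "\<epsilon> k \<le> 1" for k
    using \<epsilon>[of k] by auto
  \<comment> \<open>\<open>T k\<close> is the tail from position \<open>k\<close> on, which will be
    the fractional part of \<open>4 ^ k * T 0\<close>.\<close>
  define T where "T k = (\<Sum>j. 2 * \<epsilon> (j + k) / 4 ^ Suc j)" for k
  have geo: "(\<lambda>j. 2 / 4 ^ Suc j :: real) sums (2/3)"
    using sums_mult[OF geometric_sums[of "1/4 :: real"], of "2/4"]
    by (simp add: power_divide)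
  have le: "2 * \<epsilon> (j + k) / 4 ^ Suc j \<le> 2 / 4 ^ Suc j" for j k
    using \<epsilon>01 by (intro divide_right_mono) auto
  have nonneg: "0 \<le> 2 * \<epsilon> (j + k) / 4 ^ Suc j" for j k
    using \<epsilon>01 by simp
  have sm: "summable (\<lambda>j. 2 * \<epsilon> (j + k) / 4 ^ Suc j)" for k
    by (rule summable_comparison_test'[OF sums_summable[OF geo], of 0])
      (simp only: real_norm_def abs_of_nonneg[OF nonneg] le)
  have T: "0 \<le> T k" "T k \<le> 2/3" for k
    using suminf_nonneg[OF sm nonneg, of k] suminf_le[OF le sm sums_summable[OF geo], of k]
    unfolding T_def sums_unique[OF geo, symmetric] .
  have rec: "4 * T k = 2 * \<epsilon> k + T (Suc k)" for k
  proof -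
    have "T k = (\<Sum>j. 2 * \<epsilon> (Suc j + k) / 4 ^ Suc (Suc j)) + 2 * \<epsilon> k / 4"
      unfolding T_def using suminf_split_head[OF sm[of k]] by simp
    also have "(\<Sum>j. 2 * \<epsilon> (Suc j + k) / 4 ^ Suc (Suc j)) = (\<Sum>j. 1/4 * (2 * \<epsilon> (j + Suc k) / 4 ^ Suc j))"
      by (simp add: divide_simps)
    also have "\<dots> = 1/4 * T (Suc k)"
      unfolding T_def by (rule suminf_mult[OF sm])
    finally show ?thesis by simp
  qed
  have shift: "\<exists>n::int. 4 ^ k * T 0 = n + T k" for k
  proof (induction k)
    case (Suc k)
    then obtain n :: int where n: "4 ^ k * T 0 = n + T k" by blast
    obtain e :: int where e: "\<epsilon> k = e"
      using \<epsilon>[of k] by (metis insert_iff of_int_0 of_int_1 singletonD)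
    have "4 ^ Suc k * T 0 = of_int (4 * n + 2 * e) + T (Suc k)"
      using n rec[of k] e by simp
    then show ?case by blast
  qed (auto intro: exI[of _ 0])
  have "frac (4 ^ k * T 0) < 3/4 \<and> digit_detector (4 ^ k * T 0) = \<epsilon> k" for k
  proof -
    obtain n :: int where n: "4 ^ k * T 0 = n + T k"
      using shift by blast
    have "frac (4 ^ k * T 0) = T k"
      unfolding n using T[of k] by (simp add: frac_def floor_eq_iff)
    moreover have "cos (2 * pi * (4 ^ k * T 0)) = cos (2 * pi * T k)"
      unfolding n by (simp add: ring_distribs cos_add sin_int_2pin cos_int_2pin)
    moreover have "digit_detector (T k) = \<epsilon> k"
    proof -
      \<comment> \<open>What remains of the tail after its first digit is at most 1/6, so its cosine
        is at least 1/2. A digit 2 adds half a period and flips the sign.\<close>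
      define s where "s = T (Suc k) / 4"
      have s: "0 \<le> 2 * pi * s" "2 * pi * s \<le> pi / 3"
        using T[of "Suc k"] by (auto simp: s_def)
      then have c: "1/2 \<le> cos (2 * pi * s)"
        using cos_monotone_0_pi_le[of "2 * pi * s" "pi / 3"] by (simp add: cos_60)
      have Tk: "T k = \<epsilon> k / 2 + s"
        using rec[of k] by (simp add: s_def)
      from \<epsilon>[of k] consider "\<epsilon> k = 0" | "\<epsilon> k = 1" by auto
      then show ?thesis
      proof cases
        case 1
        then show ?thesis using c Tk by (simp add: digit_detector_def)
      next
        case 2
        then have "cos (2 * pi * T k) = - cos (2 * pi * s)"
          using Tk by (simp add: ring_distribs cos_add)
        then show ?thesis using c 2 by (simp add: digit_detector_def)
      qed
    qed
    ultimately show ?thesis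
      using T[of k] by (simp add: digit_detector_def)
  qed
  then show ?thesis
    using T[of 0] by (intro exI[of _ "T 0"]) auto
qed

text \<open>Interleaving the binary digits of \<open>u\<close> and \<open>v\<close> lets the even
  positions encode \<open>u\<close> and the odd ones \<open>v\<close>.\<close>

lemma schoenberg_surj:
  assumes "0 \<le> u" "u \<le> 1" "0 \<le> v" "v \<le> 1"
  shows "\<exists>x. 0 \<le> x \<and> x < 1 \<and> (\<forall>k. frac (4 ^ k * x) < 3/4) \<and> schoenberg 0 x = u \<and> schoenberg 1 x = v"
proof -
  obtain \<mu> \<nu> where \<mu>: "\<And>k. \<mu> k \<in> {0, 1}" "(\<lambda>k. \<mu> k / 2 ^ Suc k) sums u"
    and \<nu>: "\<And>k. \<nu> k \<in> {0, 1}" "(\<lambda>k. \<nu> k / 2 ^ Suc k) sums v"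
    using binary_expansion[of u] binary_expansion[of v] assms by blast
  define \<epsilon> where "\<epsilon> k = (if even k then \<mu> (k div 2) else \<nu> (k div 2))" for k
  have "\<epsilon> k \<in> {0, 1}" for k
    using \<mu>(1)[of "k div 2"] \<nu>(1)[of "k div 2"] by (simp add: \<epsilon>_def)
  then obtain x where "0 \<le> x" "x < 1" and x: "\<And>k. frac (4 ^ k * x) < 3/4"
      "\<And>k. digit_detector (4 ^ k * x) = \<epsilon> k"
    using point_with_digits[of \<epsilon>] by blast
  moreover have "schoenberg 0 x = u" "schoenberg 1 x = v"
    using \<mu>(2) \<nu>(2) unfolding schoenberg_def x sums_iff by (simp_all add: \<epsilon>_def)
  ultimately show ?thesis by blast
qed

section \<open>Parametrizing the triangle of centres and radii\<close>

text \<open>Sends everything outside \<open>[0, 1]\<close> to an integer, where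
  \<open>schoenberg\<close> vanishes; so \<open>center\<close> and \<open>radius\<close> extend
  continuously by zero.\<close>

definition clip :: "real \<Rightarrow> real" where
  "clip x = max 0 (min 1 x)"

text \<open>The sine covers both signs and still vanishes where \<open>schoenberg 0\<close>
  does.\<close>

definition center :: "real \<Rightarrow> real" where
  "center x = sin (2 * pi * schoenberg 0 (clip x))"

definition radius :: "real \<Rightarrow> real" where
  "radius x = schoenberg 1 (clip x) * (1 - \<bar>center x\<bar>)"

lemma isCont_center: "isCont center x" and isCont_radius: "isCont radius x"
proof -
  have "continuous_on UNIV (\<lambda>x. schoenberg m (clip x))" for m
    unfolding clip_def
    by (intro continuous_on_compose2[OF continuous_schoenberg] continuous_intros) auto
  then have "continuous_on UNIV center" "continuous_on UNIV radius"
    unfolding radius_def[abs_def] center_def[abs_def] by (auto intro!: continuous_intros)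
  then show "isCont center x" "isCont radius x"
    by (auto simp: continuous_on_eq_continuous_at)
qed

lemma radius_nonneg: "0 \<le> radius x"
  by (auto simp: radius_def center_def schoenberg_bounds)

lemma center_radius_le: "\<bar>center x\<bar> + radius x \<le> 1"
proof -
  have "radius x \<le> 1 * (1 - \<bar>center x\<bar>)"
    unfolding radius_def by (intro mult_right_mono schoenberg_bounds) (simp add: center_def)
  then show ?thesis by simp
qed

lemma center_radius_outside:
  assumes "x \<le> 0 \<or> 1 \<le> x"
  shows "center x = 0" "radius x = 0"
proof -
  have "clip x \<in> \<int>"
    using assms by (auto simp: clip_def max_def min_def)
  then show "center x = 0" "radius x = 0"
    by (simp_all add: center_def radius_def schoenberg_int)
qed

lemma center_radius_surj:
  assumes "\<bar>c\<bar> + r \<le> 1" "0 \<le> r"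
  shows "\<exists>x. x < 1 \<and> (\<forall>k. frac (4 ^ k * x) < 3/4) \<and> center x = c \<and> radius x = r"
proof -
  have c: "-1 \<le> c" "c \<le> 1"
    using assms by auto
  \<comment> \<open>For negative \<open>c\<close>, a full turn moves the angle into
    \<open>[0, 2 * pi]\<close>.\<close>
  define u where "u = (if 0 \<le> c then arcsin c else arcsin c + 2 * pi) / (2 * pi)"
  have u: "0 \<le> u" "u \<le> 1" "sin (2 * pi * u) = c"
    using c arcsin_bounded[OF c] pi_gt_zero arcsin_nonneg[of c] arcsin_le_arcsin[of c 0]
    by (auto simp: u_def divide_simps sin_add)
  \<comment> \<open>At \<open>\<bar>c\<bar> = 1\<close> the constraints force
    \<open>r = 0\<close>.\<close>
  define v where "v = (if \<bar>c\<bar> = 1 then 0 else r / (1 - \<bar>c\<bar>))"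
  have v: "0 \<le> v" "v \<le> 1" "v * (1 - \<bar>c\<bar>) = r"
    using assms c by (auto simp: v_def divide_simps)
  obtain x where x: "0 \<le> x" "x < 1" "\<forall>k. frac (4 ^ k * x) < 3/4"
      "schoenberg 0 x = u" "schoenberg 1 x = v"
    using schoenberg_surj[OF u(1,2) v(1,2)] by blast
  then have "center x = c" "radius x = r"
    using u v by (auto simp: center_def radius_def clip_def)
  then show ?thesis
    using x by blast
qed

section \<open>The function and its subdifferentials\<close>

lemma center_antiderivative:
  obtains G where "\<And>x. (G has_real_derivative center x) (at x)"
    "\<And>x. x \<le> 0 \<Longrightarrow> G x = G 0" "\<And>x. 1 \<le> x \<Longrightarrow> G x = G 1"
proof -
  obtain G where G: "\<And>x. (G has_real_derivative center x) (at x)"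
    using einterval_antiderivative[of "-\<infinity>" "\<infinity>" center] isCont_center
    by (auto simp: has_real_derivative_iff_has_vector_derivative)
  have const: "G x = G y" if "convex S" and zero: "\<And>z. z \<in> S \<Longrightarrow> center z = 0"
    and "x \<in> S" "y \<in> S" for S x y
  proof -
    have "(G has_field_derivative 0) (at z within S)" if "z \<in> S" for z
      using has_field_derivative_at_within[OF G[of z]] zero[OF that] by simp
    then show ?thesis
      using field_differentiable_bound[OF \<open>convex S\<close>, of G "\<lambda>_. 0" 0 x y] that by simp
  qed
  show ?thesis
    by (rule that[of G])
      (auto intro: G const[of "{..0}"] const[of "{1..}"] simp: center_radius_outside)
qed

theorem theorem3p7:
  "\<exists>f :: real \<Rightarrow> real.
     (\<forall>x. f differentiable (at x)) \<and>
     compact (closure {x. f x \<noteq> 0}) \<and>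
     (\<forall>x y. \<bar>f x - f y\<bar> \<le> \<bar>x - y\<bar>) \<and>
     (\<forall>a b. -1 \<le> a \<and> a \<le> b \<and> b \<le> 1 \<longrightarrow>
        (\<exists>x. \<forall>N \<in> null_sets lebesgue. clarke_subdifferential UNIV N f x = {a..b}))"
proof -
  obtain G where G: "\<And>x. (G has_real_derivative center x) (at x)"
    and G0: "\<And>x. x \<le> 0 \<Longrightarrow> G x = G 0" and G1: "\<And>x. 1 \<le> x \<Longrightarrow> G x = G 1"
    using center_antiderivative by metis
  \<comment> \<open>Reflection at 2 undoes the increment \<open>G 1 - G 0\<close>: left of 0 and
    right of 4, one of \<open>G x\<close> and \<open>G (4 - x)\<close> is \<open>G 0\<close> and the
    other \<open>G 1\<close>.\<close>
  define f where "f x = G x + G (4 - x) - G 0 - G 1 + ripple radius x" for x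
  define g where "g x = center x - center (4 - x) + ripple' radius x" for x
  have radius_le_1: "radius y \<le> 1" for y
    using center_radius_le[of y] by linarith
  note ripple' = ripple'_le[of radius, OF radius_nonneg]
  have deriv: "(f has_real_derivative g x) (at x)" for x
    unfolding f_def g_def
    by (auto intro!: derivative_eq_intros G DERIV_chain2[OF G] ripple_deriv radius_nonneg radius_le_1)
  have bound: "\<bar>g x\<bar> \<le> 1" for x
  \<comment> \<open>The two copies of \<open>center\<close> are supported in \<open>[0, 1]\<close>
    and \<open>[3, 4]\<close>, so at most one contributes, and \<open>radius\<close> lives with the
    first.\<close>
  proof (cases "x \<le> 3")
    case True
    then show ?thesis
      using ripple'[of x] center_radius_le[of x] center_radius_outside(1)[of "4 - x"]
      by (simp add: g_def)
  next
    case False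
    then show ?thesis
      using ripple'[of x] center_radius_le[of "4 - x"] radius_nonneg[of "4 - x"] center_radius_outside[of x]
      by (simp add: g_def)
  qed
  have "\<bar>f x - f y\<bar> \<le> \<bar>x - y\<bar>" for x y
    using field_differentiable_bound[of UNIV f g 1 x y] deriv bound by simp
  moreover have "{x. f x \<noteq> 0} \<subseteq> {0..4}"
  proof (clarify, rule ccontr)
    fix x assume "f x \<noteq> 0" "x \<notin> {0..4}"
    then have "f x = 0"
      using ripple_eq_0[of radius x] radius_nonneg center_radius_outside[of x]
        G0[of x] G1[of x] G0[of "4 - x"] G1[of "4 - x"]
      by (auto simp: f_def)
    with \<open>f x \<noteq> 0\<close> show False by simp
  qed
  then have "compact (closure {x. f x \<noteq> 0})"
    by (simp add: bounded_subset[OF bounded_closed_interval])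
  moreover have "\<exists>x. \<forall>N \<in> null_sets lebesgue. clarke_subdifferential UNIV N f x = {a..b}"
    if ab: "-1 \<le> a" "a \<le> b" "b \<le> 1" for a b
  proof -
    obtain x where x: "x < 1" "\<And>k. frac (4 ^ k * x) < 3/4"
      and cr: "center x = (a + b) / 2" "radius x = (b - a) / 2"
    proof -
      have "\<bar>(a + b) / 2\<bar> + (b - a) / 2 \<le> 1"
        using ab by (simp add: abs_if field_simps)
      then show ?thesis
        using center_radius_surj[of "(a + b) / 2" "(b - a) / 2"] ab that by auto
    qed
    have ab_eq: "a = center x - radius x" "b = center x + radius x"
      unfolding cr by (auto simp: field_simps)
    have g: "g y = center y + ripple' radius y" if "y < 3" for y
      using that center_radius_outside(1)[of "4 - y"] by (simp add: g_def)
    have x3: "\<forall>\<^sub>F y in nhds x. y < 3"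
      using x(1) by (intro eventually_nhds_in_open[of "{..<3}", simplified]) auto
    have "(center \<longlongrightarrow> center x) (nhds x)" "(radius \<longlongrightarrow> radius x) (nhds x)"
      using isCont_center[of x] isCont_radius[of x]
      by (simp_all add: isCont_def tendsto_at_iff_tendsto_nhds)
    then have lim: "((\<lambda>y. center y + radius y) \<longlongrightarrow> b) (nhds x)"
        "((\<lambda>y. center y - radius y) \<longlongrightarrow> a) (nhds x)"
      unfolding ab_eq by (auto intro: tendsto_intros)
    have upper: "\<forall>\<^sub>F y in nhds x. g y < b + e" if "0 < e" for e
    proof -
      have "\<forall>\<^sub>F y in nhds x. center y + radius y < b + e"
        using order_tendstoD(2)[OF lim(1), of "b + e"] \<open>0 < e\<close> by simp
      with x3 show ?thesis
      proof eventually_elim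
        case (elim y)
        then show ?case using g[of y] ripple'[of y] by linarith
      qed
    qed
    have lower: "\<forall>\<^sub>F y in nhds x. a - e < g y" if "0 < e" for e
    proof -
      have "\<forall>\<^sub>F y in nhds x. a - e < center y - radius y"
        using order_tendstoD(1)[OF lim(2), of "a - e"] \<open>0 < e\<close> by simp
      with x3 show ?thesis
      proof eventually_elim
        case (elim y)
        then show ?case using g[of y] ripple'[of y] by linarith
      qed
    qed
    \<comment> \<open>The signs 1 and -1 approach the ends \<open>b\<close> and \<open>a\<close>.
      The bound 1 in the minimum below keeps \<open>y\<close> under 3, away from the reflected
      copy.\<close>
    have osc: "\<exists>y. \<bar>y - x\<bar> < e \<and> \<bar>g y - (center x + \<sigma> * radius x)\<bar> < e"
      if "0 < e" and \<sigma>: "\<bar>\<sigma>\<bar> = 1" for e \<sigma>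
    proof -
      obtain \<delta> where \<delta>: "0 < \<delta>" "\<And>y. \<bar>y - x\<bar> < \<delta> \<Longrightarrow> \<bar>center y - center x\<bar> < e/2"
        using isCont_center[of x] \<open>0 < e\<close> unfolding continuous_at_eps_delta
        by (metis dist_real_def half_gt_zero)
      obtain y where "\<bar>y - x\<bar> < Min {\<delta>, e/2, 1}"
          "\<bar>ripple' radius y - \<sigma> * radius x\<bar> < Min {\<delta>, e/2, 1}"
        using ripple'_oscillation[OF isCont_radius radius_nonneg x(2), of "Min {\<delta>, e/2, 1}" \<sigma>] \<sigma> \<open>0 < e\<close> \<delta>(1)
        by auto
      then have y: "\<bar>y - x\<bar> < \<delta>" "\<bar>y - x\<bar> < e/2" "\<bar>y - x\<bar> < 1"
          "\<bar>ripple' radius y - \<sigma> * radius x\<bar> < e/2"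
        by auto
      moreover have "g y = center y + ripple' radius y"
        using y(3) x(1) by (intro g) linarith
      ultimately have "\<bar>y - x\<bar> < e" "\<bar>g y - (center x + \<sigma> * radius x)\<bar> < e"
        using \<delta>(2)[of y] \<open>0 < e\<close> by linarith+
      then show ?thesis by blast
    qed
    have "clarke_subdifferential UNIV N f x = {a..b}" if "N \<in> null_sets lebesgue" for N
    proof (rule clarke_subdifferential_eqI[OF deriv that upper lower _ _ ab(2)])
      fix e :: real assume "0 < e"
      show "\<exists>y. \<bar>y - x\<bar> < e \<and> b - e < g y"
        using osc[OF \<open>0 < e\<close>, of 1] unfolding ab_eq(2) by force
      show "\<exists>y. \<bar>y - x\<bar> < e \<and> g y < a + e"
        using osc[OF \<open>0 < e\<close>, of "-1"] unfolding ab_eq(1) by force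
    qed
    then show ?thesis by blast
  qed
  moreover have "f differentiable (at x)" for x
    using deriv real_differentiable_def by blast
  ultimately show ?thesis by blast
qed

end
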